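(* Let $\mathcal Q$ have objects, hom-sets that are complete lattices, and two compositions such that $(\mathcal Q,\otimes,\top_a)$ and $(\mathcal Q^{co},\oplus,\bot_a)$ are quantaloids (with the same objects and the same underlying hom-sets). Then $\mathsf{Mon}\mathcal Q$, the structure of linear monads and linear monad modules in $\mathcal Q$ with the two compositions and identities given in the context, is a linear quantaloid if and only if $\mathcal Q$ is a linear quantaloid.
   Context: A quantaloid is a category enriched in complete lattices and sup-preserving maps; composition is written in diagrammatic order. $\mathcal Q^{co}$ denotes $\mathcal Q$ with the order on each hom reversed, so $(\mathcal Q^{co},\oplus,\bot_a)$ being a quantaloid means $\oplus$ is associative with identities $\bot_a$ and preserves arbitrary infima in each variable. A linear quantaloid is such a (locally small) structure satisfying in addition, for all $f\colon a\to b$, $g\colon b\to c$, $h\colon c\to d$: $f\otimes(g\oplus h)\le(f\otimes g)\oplus h$ and $(f\oplus g)\otimes h\le f\oplus(g\otimes h)$. A linear monad $(a,m)=(a,m_\otimes,m_\oplus)$ in $\mathcal Q$ is an object $a$ with morphisms $m_\otimes,m_\oplus\colon a\to a$ such that $\top_a\le m_\otimes$, $m_\otimes\otimes m_\otimes\le m_\otimes$, $m_\oplus\le\bot_a$, $m_\oplus\le m_\oplus\oplus m_\oplus$, $m_\otimes\le m_\oplus\oplus m_\otimes$, $m_\otimes\le m_\otimes\oplus m_\oplus$, $m_\otimes\otimes m_\oplus\le m_\oplus$, $m_\oplus\otimes m_\otimes\le m_\oplus$. A linear $(m,n)$-module $f\colon(a,m)\nrightarrow(b,n)$ is a morphism $f\colon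 a\to b$ in $\mathcal Q$ with $f\otimes n_\otimes\le f$, $m_\otimes\otimes f\le f$, $f\le m_\oplus\oplus f$, $f\le f\oplus n_\oplus$. $\mathsf{Mon}\mathcal Q$ has linear monads as objects and linear modules as arrows; the order on homs and both compositions $\otimes,\oplus$ are inherited from $\mathcal Q$; the $\otimes$-identity on $(a,m)$ is $m_\otimes$ and the $\oplus$-identity is $m_\oplus$. That $\mathsf{Mon}\mathcal Q$ is a linear quantaloid includes that these compositions and identities are well defined. *)

theory Defs
  imports "HOL-Algebra.Complete_Lattice"
begin

section \<open>Quantaloids\<close>

text \<open>
  A category is given by a set of objects, a family of homs indexed by pairs of objects (each hom
  being an ordered carrier in the sense of HOL-Algebra), and compositions and identities indexed
  by objects. Since composition carries its objects as arguments, homs need not be disjoint.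
  Composition is diagrammatic: for \<open>f : a \<rightarrow> b\<close> and \<open>g : b \<rightarrow> c\<close>, the composite \<open>a \<rightarrow> c\<close> is
  \<open>comp C a b c f g\<close>.
\<close>

record ('o, 'm) ordered_category =
  objs :: "'o set"
  homs :: "'o \<Rightarrow> 'o \<Rightarrow> 'm gorder"
  comp :: "'o \<Rightarrow> 'o \<Rightarrow> 'o \<Rightarrow> 'm \<Rightarrow> 'm \<Rightarrow> 'm"
  ident :: "'o \<Rightarrow> 'm"

abbreviation arrows :: "('o, 'm) ordered_category \<Rightarrow> 'o \<Rightarrow> 'o \<Rightarrow> 'm set" where
  "arrows C a b \<equiv> carrier (homs C a b)"

locale quantaloid =
  fixes C :: "('o, 'm) ordered_category"
  assumes homs_complete_lattice:
      "\<lbrakk>a \<in> objs C; b \<in> objs C\<rbrakk> \<Longrightarrow> complete_lattice (homs C a b)"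
    and comp_closed:
      "\<lbrakk>a \<in> objs C; b \<in> objs C; c \<in> objs C; f \<in> arrows C a b; g \<in> arrows C b c\<rbrakk>
        \<Longrightarrow> comp C a b c f g \<in> arrows C a c"
    and ident_closed:
      "a \<in> objs C \<Longrightarrow> ident C a \<in> arrows C a a"
    and comp_assoc:
      "\<lbrakk>a \<in> objs C; b \<in> objs C; c \<in> objs C; d \<in> objs C;
        f \<in> arrows C a b; g \<in> arrows C b c; h \<in> arrows C c d\<rbrakk>
        \<Longrightarrow> comp C a c d (comp C a b c f g) h = comp C a b d f (comp C b c d g h)"
    and ident_left:
      "\<lbrakk>a \<in> objs C; b \<in> objs C; f \<in> arrows C a b\<rbrakk> \<Longrightarrow> comp C a a b (ident C a) f = f"
    and ident_right:
      "\<lbrakk>a \<in> objs C; b \<in> objs C; f \<in> arrows C a b\<rbrakk> \<Longrightarrow> comp C a b b f (ident C b) = f"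
    and comp_Sup_left:
      "\<lbrakk>a \<in> objs C; b \<in> objs C; c \<in> objs C; F \<subseteq> arrows C a b; g \<in> arrows C b c\<rbrakk>
        \<Longrightarrow> comp C a b c (\<Squnion>\<^bsub>homs C a b\<^esub> F) g = \<Squnion>\<^bsub>homs C a c\<^esub> ((\<lambda>f. comp C a b c f g) ` F)"
    and comp_Sup_right:
      "\<lbrakk>a \<in> objs C; b \<in> objs C; c \<in> objs C; f \<in> arrows C a b; G \<subseteq> arrows C b c\<rbrakk>
        \<Longrightarrow> comp C a b c f (\<Squnion>\<^bsub>homs C b c\<^esub> G) = \<Squnion>\<^bsub>homs C a c\<^esub> ((\<lambda>g. comp C a b c f g) ` G)"

text \<open>The local dual \<open>C\<^sup>c\<^sup>o\<close>: the same category, with the order on each hom reversed.\<close>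

definition co :: "('o, 'm) ordered_category \<Rightarrow> ('o, 'm) ordered_category" where
  "co C = C\<lparr>homs := \<lambda>a b. inv_gorder (homs C a b)\<rparr>"


section \<open>Linear quantaloids\<close>

record ('o, 'm) two_comp_category =
  Obj :: "'o set"
  Hom :: "'o \<Rightarrow> 'o \<Rightarrow> 'm gorder"
  tens :: "'o \<Rightarrow> 'o \<Rightarrow> 'o \<Rightarrow> 'm \<Rightarrow> 'm \<Rightarrow> 'm"
  topid :: "'o \<Rightarrow> 'm"
  par :: "'o \<Rightarrow> 'o \<Rightarrow> 'o \<Rightarrow> 'm \<Rightarrow> 'm \<Rightarrow> 'm"
  botid :: "'o \<Rightarrow> 'm"

text \<open>
  \<open>tens\<close> and \<open>par\<close> are the compositions \<open>\<otimes>\<close> and \<open>\<oplus>\<close>; \<open>topid\<close> and \<open>botid\<close> are their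
  identities \<open>\<top>\<^sub>a\<close> and \<open>\<bottom>\<^sub>a\<close>, which are not the extremal elements of the lattice \<open>Hom Q a a\<close>.
\<close>

abbreviation Arr :: "('o, 'm) two_comp_category \<Rightarrow> 'o \<Rightarrow> 'o \<Rightarrow> 'm set" where
  "Arr Q a b \<equiv> carrier (Hom Q a b)"

definition tens_category :: "('o, 'm) two_comp_category \<Rightarrow> ('o, 'm) ordered_category" where
  "tens_category Q = \<lparr>objs = Obj Q, homs = Hom Q, comp = tens Q, ident = topid Q\<rparr>"

definition par_category :: "('o, 'm) two_comp_category \<Rightarrow> ('o, 'm) ordered_category" where
  "par_category Q = \<lparr>objs = Obj Q, homs = Hom Q, comp = par Q, ident = botid Q\<rparr>"

locale linear_quantaloid =
  fixes Q :: "('o, 'm) two_comp_category"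
  assumes tens_quantaloid: "quantaloid (tens_category Q)"
    and par_quantaloid: "quantaloid (co (par_category Q))"
    and linear_distrib_left:
      "\<lbrakk>a \<in> Obj Q; b \<in> Obj Q; c \<in> Obj Q; d \<in> Obj Q;
        f \<in> Arr Q a b; g \<in> Arr Q b c; h \<in> Arr Q c d\<rbrakk>
        \<Longrightarrow> tens Q a b d f (par Q b c d g h) \<sqsubseteq>\<^bsub>Hom Q a d\<^esub> par Q a c d (tens Q a b c f g) h"
    and linear_distrib_right:
      "\<lbrakk>a \<in> Obj Q; b \<in> Obj Q; c \<in> Obj Q; d \<in> Obj Q;
        f \<in> Arr Q a b; g \<in> Arr Q b c; h \<in> Arr Q c d\<rbrakk>
        \<Longrightarrow> tens Q a c d (par Q a b c f g) h \<sqsubseteq>\<^bsub>Hom Q a d\<^esub> par Q a b d f (tens Q b c d g h)"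


section \<open>Linear monads and their modules\<close>

record ('o, 'm) monad_data =
  base :: 'o
  mtens :: 'm
  mpar :: 'm

definition linear_monad :: "('o, 'm) two_comp_category \<Rightarrow> ('o, 'm) monad_data \<Rightarrow> bool" where
  "linear_monad Q m \<longleftrightarrow>
    (let a = base m; mt = mtens m; mp = mpar m in
      a \<in> Obj Q \<and> mt \<in> Arr Q a a \<and> mp \<in> Arr Q a a \<and>
      topid Q a \<sqsubseteq>\<^bsub>Hom Q a a\<^esub> mt \<and>
      tens Q a a a mt mt \<sqsubseteq>\<^bsub>Hom Q a a\<^esub> mt \<and>
      mp \<sqsubseteq>\<^bsub>Hom Q a a\<^esub> botid Q a \<and>
      mp \<sqsubseteq>\<^bsub>Hom Q a a\<^esub> par Q a a a mp mp \<and>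
      mt \<sqsubseteq>\<^bsub>Hom Q a a\<^esub> par Q a a a mp mt \<and>
      mt \<sqsubseteq>\<^bsub>Hom Q a a\<^esub> par Q a a a mt mp \<and>
      tens Q a a a mt mp \<sqsubseteq>\<^bsub>Hom Q a a\<^esub> mp \<and>
      tens Q a a a mp mt \<sqsubseteq>\<^bsub>Hom Q a a\<^esub> mp)"

definition linear_module ::
  "('o, 'm) two_comp_category \<Rightarrow> ('o, 'm) monad_data \<Rightarrow> ('o, 'm) monad_data \<Rightarrow> 'm \<Rightarrow> bool" where
  "linear_module Q m n f \<longleftrightarrow>
    (let a = base m; b = base n in
      f \<in> Arr Q a b \<and>
      tens Q a b b f (mtens n) \<sqsubseteq>\<^bsub>Hom Q a b\<^esub> f \<and>
      tens Q a a b (mtens m) f \<sqsubseteq>\<^bsub>Hom Q a b\<^esub> f \<and>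
      f \<sqsubseteq>\<^bsub>Hom Q a b\<^esub> par Q a a b (mpar m) f \<and>
      f \<sqsubseteq>\<^bsub>Hom Q a b\<^esub> par Q a b b f (mpar n))"

definition Mon :: "('o, 'm) two_comp_category \<Rightarrow> (('o, 'm) monad_data, 'm) two_comp_category" where
  "Mon Q =
    \<lparr>Obj = {m. linear_monad Q m},
     Hom = (\<lambda>m n. (Hom Q (base m) (base n))\<lparr>carrier := {f. linear_module Q m n f}\<rparr>),
     tens = (\<lambda>m n k. tens Q (base m) (base n) (base k)),
     topid = mtens,
     par = (\<lambda>m n k. par Q (base m) (base n) (base k)),
     botid = mpar\<rparr>"

end

theory Submission
  imports Defs
begin

text \<open>
  Modules between linear monads are closed under all suprema, all infima and both compositions
  in \<open>Q\<close>; the linear distributive laws are what makes a \<open>\<otimes>\<close>-composite of modules again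
  compatible with the \<open>\<oplus>\<close>-coactions, and dually. A monad is a two-sided unit for its own modules
  because \<open>f = \<top> \<otimes> f \<le> m\<^sub>\<otimes> \<otimes> f \<le> f\<close>. Conversely, the pairs \<open>(\<top>\<^sub>a, \<bottom>\<^sub>a)\<close> are linear monads whose
  modules are all arrows of \<open>Q\<close>, so \<open>Q\<close> embeds in \<open>Mon Q\<close> and inherits the distributive laws.
  Statements about \<open>\<oplus>\<close> are obtained from those about \<open>\<otimes>\<close> by reversing the order and swapping the
  two compositions.
\<close>

section \<open>Subquantaloids\<close>

text \<open>Bounds formed in \<open>L\<close> that land in \<open>S\<close> are still the best
  bounds when only elements of \<open>S\<close> compete. The case of empty \<open>F\<close> puts
  both extremal elements of \<open>L\<close> into \<open>S\<close>. The second claim lets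
  preservation of suprema pass from \<open>L\<close> to \<open>S\<close>.\<close>

lemma (in complete_lattice)
  assumes S: "S \<subseteq> carrier L"
    and Sup_closed: "\<And>F. F \<subseteq> S \<Longrightarrow> \<Squnion>\<^bsub>L\<^esub> F \<in> S"
    and Inf_closed: "\<And>F. F \<subseteq> S \<Longrightarrow> \<Sqinter>\<^bsub>L\<^esub> F \<in> S"
  shows complete_sublattice: "complete_lattice (L\<lparr>carrier := S\<rparr>)" (is "complete_lattice ?M")
    and complete_sublattice_sup: "F \<subseteq> S \<Longrightarrow> \<Squnion>\<^bsub>L\<lparr>carrier := S\<rparr>\<^esub> F = \<Squnion>\<^bsub>L\<^esub> F"
proof -
  have "weak_partial_order ?M"
    using S by (rule weak_partial_order_subset[OF weak_partial_order_axioms])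
  then interpret M: partial_order ?M
    by (simp add: partial_order_def partial_order_axioms_def eq_is_equal)
  have least: "least ?M (\<Squnion>\<^bsub>L\<^esub> F) (Upper ?M F)" if "F \<subseteq> S" for F
  proof (rule least_UpperI)
    have F: "F \<subseteq> carrier L" using that S by blast
    show "x \<sqsubseteq>\<^bsub>?M\<^esub> \<Squnion>\<^bsub>L\<^esub> F" if "x \<in> F" for x
      using sup_upper[OF F that] by simp
    show "\<Squnion>\<^bsub>L\<^esub> F \<sqsubseteq>\<^bsub>?M\<^esub> y" if "y \<in> Upper ?M F" for y
      using that F S \<open>F \<subseteq> S\<close> by (auto simp: Upper_def intro!: sup_least)
  qed (use that Sup_closed in auto)
  have greatest: "greatest ?M (\<Sqinter>\<^bsub>L\<^esub> F) (Lower ?M F)" if "F \<subseteq> S" for F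
  proof (rule greatest_LowerI)
    have F: "F \<subseteq> carrier L" using that S by blast
    show "\<Sqinter>\<^bsub>L\<^esub> F \<sqsubseteq>\<^bsub>?M\<^esub> x" if "x \<in> F" for x
      using inf_lower[OF F that] by simp
    show "y \<sqsubseteq>\<^bsub>?M\<^esub> \<Sqinter>\<^bsub>L\<^esub> F" if "y \<in> Lower ?M F" for y
      using that F S \<open>F \<subseteq> S\<close> by (auto simp: Lower_def intro!: inf_greatest)
  qed (use that Inf_closed in auto)
  show cl: "complete_lattice ?M"
    by (rule M.complete_latticeI) (auto intro: least greatest)
  then interpret MC: complete_lattice ?M .
  show "\<Squnion>\<^bsub>?M\<^esub> F = \<Squnion>\<^bsub>L\<^esub> F" if "F \<subseteq> S"
    \<comment> \<open>Both sides are least among the upper bounds of \<open>F\<close> in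
      \<open>S\<close>.\<close>
    using M.least_unique[OF MC.sup_lub least] that by simp
qed

context quantaloid
begin

text \<open>Monotonicity is not an axiom of \<open>quantaloid\<close>: it follows from preservation
  of the supremum of \<open>{f, f'}\<close>, which is \<open>f'\<close> when \<open>f\<close> lies
  below \<open>f'\<close>.\<close>

lemma comp_mono_left:
  assumes "a \<in> objs C" "b \<in> objs C" "c \<in> objs C"
    and f: "f \<in> arrows C a b" and f': "f' \<in> arrows C a b" and g: "g \<in> arrows C b c"
    and le: "f \<sqsubseteq>\<^bsub>homs C a b\<^esub> f'"
  shows "comp C a b c f g \<sqsubseteq>\<^bsub>homs C a c\<^esub> comp C a b c f' g"
proof -
  interpret ab: complete_lattice "homs C a b" using assms homs_complete_lattice by blast
  interpret ac: complete_lattice "homs C a c" using assms homs_complete_lattice by blast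
  have "\<Squnion>\<^bsub>homs C a b\<^esub> {f, f'} = f'"
    using f f' le ab.sup_upper[of "{f, f'}" f']
    by (intro ab.le_antisym ab.sup_least) auto
  then have "comp C a b c f' g = \<Squnion>\<^bsub>homs C a c\<^esub> ((\<lambda>f. comp C a b c f g) ` {f, f'})"
    using comp_Sup_left[of a b c "{f, f'}" g] assms by simp
  then show ?thesis
    using ac.sup_upper[of "(\<lambda>f. comp C a b c f g) ` {f, f'}" "comp C a b c f g"] assms comp_closed
    by simp
qed

lemma comp_mono_right:
  assumes "a \<in> objs C" "b \<in> objs C" "c \<in> objs C"
    and f: "f \<in> arrows C a b" and g: "g \<in> arrows C b c" and g': "g' \<in> arrows C b c"
    and le: "g \<sqsubseteq>\<^bsub>homs C b c\<^esub> g'"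
  shows "comp C a b c f g \<sqsubseteq>\<^bsub>homs C a c\<^esub> comp C a b c f g'"
proof -
  interpret bc: complete_lattice "homs C b c" using assms homs_complete_lattice by blast
  interpret ac: complete_lattice "homs C a c" using assms homs_complete_lattice by blast
  have "\<Squnion>\<^bsub>homs C b c\<^esub> {g, g'} = g'"
    using g g' le bc.sup_upper[of "{g, g'}" g']
    by (intro bc.le_antisym bc.sup_least) auto
  then have "comp C a b c f g' = \<Squnion>\<^bsub>homs C a c\<^esub> ((\<lambda>g. comp C a b c f g) ` {g, g'})"
    using comp_Sup_right[of a b c f "{g, g'}"] assms by simp
  then show ?thesis
    using ac.sup_upper[of "(\<lambda>g. comp C a b c f g) ` {g, g'}" "comp C a b c f g"] assms comp_closed
    by simp
qed

text \<open>Associativity and preservation of suprema are inherited from \<open>C\<close>, since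
  suprema in \<open>S x y\<close> agree with those in \<open>C\<close>. The unit laws are hypotheses
  because \<open>e x\<close> may differ from the identity of \<open>C\<close> on \<open>B x\<close>.
  As \<open>B\<close> may fail to be injective, many objects can lie over one object of
  \<open>C\<close>, as linear monads do via \<open>base\<close>.\<close>

lemma subquantaloid:
  fixes B :: "'p \<Rightarrow> 'o"
  assumes B: "\<And>x. x \<in> M \<Longrightarrow> B x \<in> objs C"
    and S: "\<And>x y. x \<in> M \<Longrightarrow> y \<in> M \<Longrightarrow> S x y \<subseteq> arrows C (B x) (B y)"
    and Sup: "\<And>x y F. x \<in> M \<Longrightarrow> y \<in> M \<Longrightarrow> F \<subseteq> S x y \<Longrightarrow> \<Squnion>\<^bsub>homs C (B x) (B y)\<^esub> F \<in> S x y"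
    and Inf: "\<And>x y F. x \<in> M \<Longrightarrow> y \<in> M \<Longrightarrow> F \<subseteq> S x y \<Longrightarrow> \<Sqinter>\<^bsub>homs C (B x) (B y)\<^esub> F \<in> S x y"
    and cl: "\<And>x y z f g. x \<in> M \<Longrightarrow> y \<in> M \<Longrightarrow> z \<in> M \<Longrightarrow> f \<in> S x y \<Longrightarrow> g \<in> S y z
      \<Longrightarrow> comp C (B x) (B y) (B z) f g \<in> S x z"
    and id: "\<And>x. x \<in> M \<Longrightarrow> e x \<in> S x x"
    and left: "\<And>x y f. x \<in> M \<Longrightarrow> y \<in> M \<Longrightarrow> f \<in> S x y \<Longrightarrow> comp C (B x) (B x) (B y) (e x) f = f"
    and right: "\<And>x y f. x \<in> M \<Longrightarrow> y \<in> M \<Longrightarrow> f \<in> S x y \<Longrightarrow> comp C (B x) (B y) (B y) f (e y) = f"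
  shows "quantaloid \<lparr>objs = M, homs = \<lambda>x y. (homs C (B x) (B y))\<lparr>carrier := S x y\<rparr>,
    comp = \<lambda>x y z. comp C (B x) (B y) (B z), ident = e\<rparr>"
proof -
  have lat: "complete_lattice (homs C (B x) (B y))" if "x \<in> M" "y \<in> M" for x y
    using that B homs_complete_lattice by blast
  have sub: "complete_lattice ((homs C (B x) (B y))\<lparr>carrier := S x y\<rparr>)" if "x \<in> M" "y \<in> M" for x y
    using that S Sup Inf by (intro complete_lattice.complete_sublattice[OF lat]) auto
  have sup: "\<Squnion>\<^bsub>(homs C (B x) (B y))\<lparr>carrier := S x y\<rparr>\<^esub> F = \<Squnion>\<^bsub>homs C (B x) (B y)\<^esub> F"
    if "x \<in> M" "y \<in> M" "F \<subseteq> S x y" for x y F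
    using that S Sup Inf by (intro complete_lattice.complete_sublattice_sup[OF lat]) auto
  have assoc: "comp C (B x) (B z) (B w) (comp C (B x) (B y) (B z) f g) h
      = comp C (B x) (B y) (B w) f (comp C (B y) (B z) (B w) g h)"
    if "x \<in> M" "y \<in> M" "z \<in> M" "w \<in> M" "f \<in> S x y" "g \<in> S y z" "h \<in> S z w" for x y z w f g h
    using that S B by (meson comp_assoc subsetD)
  have Sup_left: "comp C (B x) (B y) (B z) (\<Squnion>\<^bsub>(homs C (B x) (B y))\<lparr>carrier := S x y\<rparr>\<^esub> F) g
      = \<Squnion>\<^bsub>(homs C (B x) (B z))\<lparr>carrier := S x z\<rparr>\<^esub> ((\<lambda>f. comp C (B x) (B y) (B z) f g) ` F)"
    if M: "x \<in> M" "y \<in> M" "z \<in> M" and F: "F \<subseteq> S x y" and g: "g \<in> S y z" for x y z F g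
  proof -
    \<comment> \<open>The supremum on the right is taken in the restricted hom; it agrees with the
      one in \<open>C\<close> only once the image is known to lie in \<open>S x z\<close>.\<close>
    have "(\<lambda>f. comp C (B x) (B y) (B z) f g) ` F \<subseteq> S x z"
      using cl[OF M] F g by blast
    moreover have "F \<subseteq> arrows C (B x) (B y)" "g \<in> arrows C (B y) (B z)"
      using F g S M by blast+
    ultimately show ?thesis
      using sup M F B by (simp add: comp_Sup_left)
  qed
  have Sup_right: "comp C (B x) (B y) (B z) f (\<Squnion>\<^bsub>(homs C (B y) (B z))\<lparr>carrier := S y z\<rparr>\<^esub> G)
      = \<Squnion>\<^bsub>(homs C (B x) (B z))\<lparr>carrier := S x z\<rparr>\<^esub> ((\<lambda>g. comp C (B x) (B y) (B z) f g) ` G)"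
    if M: "x \<in> M" "y \<in> M" "z \<in> M" and f: "f \<in> S x y" and G: "G \<subseteq> S y z" for x y z f G
  proof -
    have "(\<lambda>g. comp C (B x) (B y) (B z) f g) ` G \<subseteq> S x z"
      using cl[OF M] f G by blast
    moreover have "f \<in> arrows C (B x) (B y)" "G \<subseteq> arrows C (B y) (B z)"
      using f G S M by blast+
    ultimately show ?thesis
      using sup M G B by (simp add: comp_Sup_right)
  qed
  show ?thesis
    by (rule quantaloid.intro) (simp_all add: sub cl id left right assoc Sup_left Sup_right)
qed

end

section \<open>Duality\<close>

definition dual :: "('o, 'm) two_comp_category \<Rightarrow> ('o, 'm) two_comp_category" where
  "dual Q = \<lparr>Obj = Obj Q, Hom = \<lambda>a b. inv_gorder (Hom Q a b),
     tens = par Q, topid = botid Q, par = tens Q, botid = topid Q\<rparr>"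

definition dual_monad :: "('o, 'm) monad_data \<Rightarrow> ('o, 'm) monad_data" where
  "dual_monad m = \<lparr>base = base m, mtens = mpar m, mpar = mtens m\<rparr>"

lemma dual_simps [simp]:
  "Obj (dual Q) = Obj Q" "Hom (dual Q) a b = inv_gorder (Hom Q a b)"
  "tens (dual Q) = par Q" "topid (dual Q) = botid Q"
  "par (dual Q) = tens Q" "botid (dual Q) = topid Q"
  by (simp_all add: dual_def)

lemma dual_monad_simps [simp]:
  "base (dual_monad m) = base m" "mtens (dual_monad m) = mpar m" "mpar (dual_monad m) = mtens m"
  by (simp_all add: dual_monad_def)

lemma tens_category_simps [simp]:
  "objs (tens_category Q) = Obj Q" "homs (tens_category Q) = Hom Q"
  "comp (tens_category Q) = tens Q" "ident (tens_category Q) = topid Q"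
  by (simp_all add: tens_category_def)

lemma co_par_category_simps [simp]:
  "objs (co (par_category Q)) = Obj Q"
  "homs (co (par_category Q)) = (\<lambda>a b. inv_gorder (Hom Q a b))"
  "comp (co (par_category Q)) = par Q" "ident (co (par_category Q)) = botid Q"
  by (simp_all add: co_def par_category_def)

lemma tens_category_dual: "tens_category (dual Q) = co (par_category Q)"
  by (simp add: tens_category_def co_def par_category_def dual_def)

lemma co_par_category_dual: "co (par_category (dual Q)) = tens_category Q"
  by (simp add: tens_category_def co_def par_category_def dual_def fun_eq_iff)

text \<open>Duality permutes the eight inequalities: unit with counit, multiplication with
  comultiplication, and each coaction on \<open>mtens m\<close> with an action on
  \<open>mpar m\<close>.\<close>

lemma linear_monad_dual: "linear_monad (dual Q) (dual_monad m) \<longleftrightarrow> linear_monad Q m"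
  by (auto simp: linear_monad_def Let_def)

lemma linear_module_dual:
  "linear_module (dual Q) (dual_monad m) (dual_monad n) f \<longleftrightarrow> linear_module Q m n f"
  by (auto simp: linear_module_def Let_def)

text \<open>The two quantaloid structures change places, and so do the two distributive
  laws.\<close>

lemma linear_quantaloid_dual:
  assumes "linear_quantaloid Q"
  shows "linear_quantaloid (dual Q)"
proof -
  interpret linear_quantaloid Q by fact
  show ?thesis
    by (rule linear_quantaloid.intro)
      (auto simp: tens_category_dual co_par_category_dual tens_quantaloid par_quantaloid
        intro: linear_distrib_left linear_distrib_right)
qed

section \<open>Linear monads and modules in a linear quantaloid\<close>

lemma linear_monadD:
  assumes "linear_monad Q m"
  shows "base m \<in> Obj Q" "mtens m \<in> Arr Q (base m) (base m)" "mpar m \<in> Arr Q (base m) (base m)"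
    and "topid Q (base m) \<sqsubseteq>\<^bsub>Hom Q (base m) (base m)\<^esub> mtens m"
  using assms by (auto simp: linear_monad_def Let_def)

lemma linear_moduleD:
  assumes "linear_module Q m n f"
  shows "f \<in> Arr Q (base m) (base n)"
    and "tens Q (base m) (base n) (base n) f (mtens n) \<sqsubseteq>\<^bsub>Hom Q (base m) (base n)\<^esub> f"
    and "tens Q (base m) (base m) (base n) (mtens m) f \<sqsubseteq>\<^bsub>Hom Q (base m) (base n)\<^esub> f"
    and "f \<sqsubseteq>\<^bsub>Hom Q (base m) (base n)\<^esub> par Q (base m) (base m) (base n) (mpar m) f"
    and "f \<sqsubseteq>\<^bsub>Hom Q (base m) (base n)\<^esub> par Q (base m) (base n) (base n) f (mpar n)"
  using assms by (auto simp: linear_module_def Let_def)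

text \<open>All four module inequalities for \<open>mtens m\<close> occur among the monad
  axioms.\<close>

lemma linear_module_mtens:
  assumes "linear_monad Q m"
  shows "linear_module Q m m (mtens m)"
  using assms by (auto simp: linear_module_def linear_monad_def Let_def)

context linear_quantaloid
begin

sublocale tens: quantaloid "tens_category Q"
  rewrites "objs (tens_category Q) = Obj Q" and "homs (tens_category Q) = Hom Q"
    and "comp (tens_category Q) = tens Q" and "ident (tens_category Q) = topid Q"
  by (rule tens_quantaloid) simp_all

sublocale par: quantaloid "co (par_category Q)"
  rewrites "objs (co (par_category Q)) = Obj Q"
    and "homs (co (par_category Q)) = (\<lambda>a b. inv_gorder (Hom Q a b))"
    and "comp (co (par_category Q)) = par Q" and "ident (co (par_category Q)) = botid Q"
  by (rule par_quantaloid) simp_all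

lemmas Hom_complete_lattice = tens.homs_complete_lattice

lemma par_closed:
  "\<lbrakk>a \<in> Obj Q; b \<in> Obj Q; c \<in> Obj Q; f \<in> Arr Q a b; g \<in> Arr Q b c\<rbrakk> \<Longrightarrow> par Q a b c f g \<in> Arr Q a c"
  using par.comp_closed by simp

text \<open>Homs of the \<open>par\<close> quantaloid carry the reversed order, so its monotonicity
  is applied with \<open>f\<close> and \<open>f'\<close> exchanged.\<close>

lemma par_mono_left:
  "\<lbrakk>a \<in> Obj Q; b \<in> Obj Q; c \<in> Obj Q; f \<in> Arr Q a b; f' \<in> Arr Q a b; g \<in> Arr Q b c;
    f \<sqsubseteq>\<^bsub>Hom Q a b\<^esub> f'\<rbrakk> \<Longrightarrow> par Q a b c f g \<sqsubseteq>\<^bsub>Hom Q a c\<^esub> par Q a b c f' g"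
  using par.comp_mono_left[of a b c f' f g] by simp

lemma par_mono_right:
  "\<lbrakk>a \<in> Obj Q; b \<in> Obj Q; c \<in> Obj Q; f \<in> Arr Q a b; g \<in> Arr Q b c; g' \<in> Arr Q b c;
    g \<sqsubseteq>\<^bsub>Hom Q b c\<^esub> g'\<rbrakk> \<Longrightarrow> par Q a b c f g \<sqsubseteq>\<^bsub>Hom Q a c\<^esub> par Q a b c f g'"
  using par.comp_mono_right[of a b c f g' g] by simp

section \<open>Unit laws for modules; closure under \<open>tens\<close> and suprema\<close>

lemma mtens_left_ident:
  assumes m: "linear_monad Q m" and n: "linear_monad Q n" and f: "linear_module Q m n f"
  shows "tens Q (base m) (base m) (base n) (mtens m) f = f"
proof -
  note M = linear_monadD[OF m] and N = linear_monadD[OF n] and F = linear_moduleD[OF f]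
  interpret complete_lattice "Hom Q (base m) (base n)" using M N Hom_complete_lattice by blast
  \<comment> \<open>The left side is \<open>f\<close> itself; the opposite inequality is the module
    axiom.\<close>
  have "tens Q (base m) (base m) (base n) (topid Q (base m)) f
    \<sqsubseteq>\<^bsub>Hom Q (base m) (base n)\<^esub> tens Q (base m) (base m) (base n) (mtens m) f"
    using M N F by (intro tens.comp_mono_left) (auto intro: tens.ident_closed)
  then show ?thesis
    using M N F by (intro le_antisym) (auto simp: tens.ident_left intro: tens.comp_closed)
qed

lemma mtens_right_ident:
  assumes m: "linear_monad Q m" and n: "linear_monad Q n" and f: "linear_module Q m n f"
  shows "tens Q (base m) (base n) (base n) f (mtens n) = f"
proof -
  note M = linear_monadD[OF m] and N = linear_monadD[OF n] and F = linear_moduleD[OF f]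
  interpret complete_lattice "Hom Q (base m) (base n)" using M N Hom_complete_lattice by blast
  have "tens Q (base m) (base n) (base n) f (topid Q (base n))
    \<sqsubseteq>\<^bsub>Hom Q (base m) (base n)\<^esub> tens Q (base m) (base n) (base n) f (mtens n)"
    using M N F by (intro tens.comp_mono_right) (auto intro: tens.ident_closed)
  then show ?thesis
    using M N F by (intro le_antisym) (auto simp: tens.ident_right intro: tens.comp_closed)
qed

lemma linear_module_tens:
  assumes m: "linear_monad Q m" and n: "linear_monad Q n" and k: "linear_monad Q k"
    and f: "linear_module Q m n f" and g: "linear_module Q n k g"
  shows "linear_module Q m k (tens Q (base m) (base n) (base k) f g)"
proof -
  let ?a = "base m" and ?b = "base n" and ?c = "base k"
  note M = linear_monadD[OF m] and N = linear_monadD[OF n] and K = linear_monadD[OF k]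
  note F = linear_moduleD[OF f] and G = linear_moduleD[OF g]
  let ?fg = "tens Q ?a ?b ?c f g"
  interpret complete_lattice "Hom Q ?a ?c" using M K Hom_complete_lattice by blast
  have fg: "?fg \<in> Arr Q ?a ?c"
    using M N K F G by (auto intro: tens.comp_closed)
  \<comment> \<open>Reassociating lets the outer monad act on the adjacent factor alone, where it
    acts as a unit.\<close>
  have "tens Q ?a ?c ?c ?fg (mtens k) = ?fg"
    using M N K F G mtens_right_ident[OF n k g] by (simp add: tens.comp_assoc)
  moreover have "tens Q ?a ?a ?c (mtens m) ?fg = ?fg"
    using M N K F G mtens_left_ident[OF m n f] tens.comp_assoc[of ?a ?a ?b ?c "mtens m" f g] by simp
  \<comment> \<open>The coaction is first applied to \<open>f\<close> inside the composite; a
    distributive law then moves \<open>mpar m\<close> outside.\<close>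
  moreover have "?fg \<sqsubseteq>\<^bsub>Hom Q ?a ?c\<^esub> par Q ?a ?a ?c (mpar m) ?fg"
  proof (rule le_trans)
    show "?fg \<sqsubseteq>\<^bsub>Hom Q ?a ?c\<^esub> tens Q ?a ?b ?c (par Q ?a ?a ?b (mpar m) f) g"
      using M N K F G by (intro tens.comp_mono_left) (auto intro: par_closed)
    show "tens Q ?a ?b ?c (par Q ?a ?a ?b (mpar m) f) g \<sqsubseteq>\<^bsub>Hom Q ?a ?c\<^esub> par Q ?a ?a ?c (mpar m) ?fg"
      using M N K F G by (intro linear_distrib_right) auto
  qed (use M N K F G in \<open>auto intro!: par_closed tens.comp_closed\<close>)
  moreover have "?fg \<sqsubseteq>\<^bsub>Hom Q ?a ?c\<^esub> par Q ?a ?c ?c ?fg (mpar k)"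
  proof (rule le_trans)
    show "?fg \<sqsubseteq>\<^bsub>Hom Q ?a ?c\<^esub> tens Q ?a ?b ?c f (par Q ?b ?c ?c g (mpar k))"
      using M N K F G by (intro tens.comp_mono_right) (auto intro: par_closed)
    show "tens Q ?a ?b ?c f (par Q ?b ?c ?c g (mpar k)) \<sqsubseteq>\<^bsub>Hom Q ?a ?c\<^esub> par Q ?a ?c ?c ?fg (mpar k)"
      using M N K F G by (intro linear_distrib_left) auto
  qed (use M N K F G in \<open>auto intro!: par_closed tens.comp_closed\<close>)
  ultimately show ?thesis
    using fg by (simp add: linear_module_def Let_def)
qed

text \<open>The two kinds of condition need different arguments. \<open>tens\<close> preserves
  suprema, so the actions can be computed memberwise. \<open>par\<close> preserves infima instead,
  but monotonicity suffices for the coactions: each member lies below its own coaction, hence below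
  that of the supremum.\<close>

lemma linear_module_Sup:
  assumes m: "linear_monad Q m" and n: "linear_monad Q n"
    and F: "\<And>f. f \<in> F \<Longrightarrow> linear_module Q m n f"
  shows "linear_module Q m n (\<Squnion>\<^bsub>Hom Q (base m) (base n)\<^esub> F)"
proof -
  let ?a = "base m" and ?b = "base n"
  let ?s = "\<Squnion>\<^bsub>Hom Q ?a ?b\<^esub> F"
  note M = linear_monadD[OF m] and N = linear_monadD[OF n]
  interpret complete_lattice "Hom Q ?a ?b" using M N Hom_complete_lattice by blast
  note D = linear_moduleD[OF F]
  have FA: "F \<subseteq> Arr Q ?a ?b" using D(1) by blast
  then have s: "?s \<in> Arr Q ?a ?b" by simp
  have up: "f \<sqsubseteq>\<^bsub>Hom Q ?a ?b\<^esub> ?s" if "f \<in> F" for f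
    using sup_upper[OF FA that] .
  have "tens Q ?a ?b ?b ?s (mtens n) = \<Squnion>\<^bsub>Hom Q ?a ?b\<^esub> ((\<lambda>f. tens Q ?a ?b ?b f (mtens n)) ` F)"
    using M N FA by (simp add: tens.comp_Sup_left)
  also have "\<dots> = ?s"
    using mtens_right_ident[OF m n F] by simp
  finally have 1: "tens Q ?a ?b ?b ?s (mtens n) = ?s" .
  have "tens Q ?a ?a ?b (mtens m) ?s = \<Squnion>\<^bsub>Hom Q ?a ?b\<^esub> ((\<lambda>f. tens Q ?a ?a ?b (mtens m) f) ` F)"
    using M N FA by (simp add: tens.comp_Sup_right)
  also have "\<dots> = ?s"
    using mtens_left_ident[OF m n F] by simp
  finally have 2: "tens Q ?a ?a ?b (mtens m) ?s = ?s" .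
  have 3: "?s \<sqsubseteq>\<^bsub>Hom Q ?a ?b\<^esub> par Q ?a ?a ?b (mpar m) ?s"
  proof (rule sup_least[OF FA])
    show c: "par Q ?a ?a ?b (mpar m) ?s \<in> Arr Q ?a ?b"
      using M N s by (intro par_closed)
    fix f assume f: "f \<in> F"
    have "par Q ?a ?a ?b (mpar m) f \<sqsubseteq>\<^bsub>Hom Q ?a ?b\<^esub> par Q ?a ?a ?b (mpar m) ?s"
      using M N s D(1)[OF f] up[OF f] by (intro par_mono_right)
    then show "f \<sqsubseteq>\<^bsub>Hom Q ?a ?b\<^esub> par Q ?a ?a ?b (mpar m) ?s"
      using le_trans[OF D(4)[OF f]] D(1)[OF f] M N c by (simp add: par_closed)
  qed
  have 4: "?s \<sqsubseteq>\<^bsub>Hom Q ?a ?b\<^esub> par Q ?a ?b ?b ?s (mpar n)"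
  proof (rule sup_least[OF FA])
    show c: "par Q ?a ?b ?b ?s (mpar n) \<in> Arr Q ?a ?b"
      using M N s by (intro par_closed)
    fix f assume f: "f \<in> F"
    have "par Q ?a ?b ?b f (mpar n) \<sqsubseteq>\<^bsub>Hom Q ?a ?b\<^esub> par Q ?a ?b ?b ?s (mpar n)"
      using M N s D(1)[OF f] up[OF f] by (intro par_mono_left)
    then show "f \<sqsubseteq>\<^bsub>Hom Q ?a ?b\<^esub> par Q ?a ?b ?b ?s (mpar n)"
      using le_trans[OF D(5)[OF f]] D(1)[OF f] M N c by (simp add: par_closed)
  qed
  show ?thesis
    using s 1 2 3 4 by (simp add: linear_module_def Let_def)
qed

section \<open>Dual closure properties and unit laws\<close>

interpretation D: linear_quantaloid "dual Q"
  by (rule linear_quantaloid_dual) (rule linear_quantaloid_axioms)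

text \<open>A supremum in a hom of \<open>dual Q\<close> is an infimum in \<open>Q\<close>.\<close>

lemma linear_module_Inf:
  assumes "linear_monad Q m" "linear_monad Q n"
    and "\<And>f. f \<in> F \<Longrightarrow> linear_module Q m n f"
  shows "linear_module Q m n (\<Sqinter>\<^bsub>Hom Q (base m) (base n)\<^esub> F)"
  using D.linear_module_Sup[of "dual_monad m" "dual_monad n" F] assms
  by (simp add: linear_monad_dual linear_module_dual)

lemma linear_module_par:
  assumes "linear_monad Q m" "linear_monad Q n" "linear_monad Q k"
    and "linear_module Q m n f" "linear_module Q n k g"
  shows "linear_module Q m k (par Q (base m) (base n) (base k) f g)"
  using D.linear_module_tens[of "dual_monad m" "dual_monad n" "dual_monad k" f g] assms
  by (simp add: linear_monad_dual linear_module_dual)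

lemma linear_module_mpar:
  assumes "linear_monad Q m"
  shows "linear_module Q m m (mpar m)"
  using linear_module_mtens[of "dual Q" "dual_monad m"] assms
  by (simp add: linear_monad_dual linear_module_dual)

lemma mpar_left_ident:
  assumes "linear_monad Q m" "linear_monad Q n" "linear_module Q m n f"
  shows "par Q (base m) (base m) (base n) (mpar m) f = f"
  using D.mtens_left_ident[of "dual_monad m" "dual_monad n" f] assms
  by (simp add: linear_monad_dual linear_module_dual)

lemma mpar_right_ident:
  assumes "linear_monad Q m" "linear_monad Q n" "linear_module Q m n f"
  shows "par Q (base m) (base n) (base n) f (mpar n) = f"
  using D.mtens_right_ident[of "dual_monad m" "dual_monad n" f] assms
  by (simp add: linear_monad_dual linear_module_dual)

section \<open>The linear quantaloid of monads and modules\<close>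

lemma quantaloid_tens_Mon: "quantaloid (tens_category (Mon Q))"
  unfolding tens_category_def Mon_def two_comp_category.simps
  by (rule tens.subquantaloid)
    (auto simp: mtens_left_ident mtens_right_ident linear_monadD(1) linear_moduleD(1)
      intro: linear_module_Sup linear_module_Inf linear_module_tens linear_module_mtens)

lemma quantaloid_co_par_Mon: "quantaloid (co (par_category (Mon Q)))"
proof -
  \<comment> \<open>Here the order is reversed before the carrier is restricted, as
    \<open>subquantaloid\<close> requires; \<open>co\<close> applied to \<open>Mon Q\<close> does it
    in the other order, with the same result.\<close>
  have "quantaloid \<lparr>objs = {m. linear_monad Q m},
    homs = \<lambda>m n. (inv_gorder (Hom Q (base m) (base n)))\<lparr>carrier := {f. linear_module Q m n f}\<rparr>,
    comp = \<lambda>m n k. par Q (base m) (base n) (base k), ident = mpar\<rparr>"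
    by (rule par.subquantaloid)
      (auto simp: mpar_left_ident mpar_right_ident linear_monadD(1) linear_moduleD(1)
        intro: linear_module_Sup linear_module_Inf linear_module_par linear_module_mpar)
  then show ?thesis
    by (simp add: co_def par_category_def Mon_def)
qed

lemma linear_quantaloid_Mon: "linear_quantaloid (Mon Q)"
proof (rule linear_quantaloid.intro[OF quantaloid_tens_Mon quantaloid_co_par_Mon])
qed (auto simp: Mon_def dest: linear_monadD(1) linear_moduleD(1)
      intro!: linear_distrib_left linear_distrib_right)

end

section \<open>Trivial monads\<close>

definition trivial_monad :: "('o, 'm) two_comp_category \<Rightarrow> 'o \<Rightarrow> ('o, 'm) monad_data" where
  "trivial_monad Q a = \<lparr>base = a, mtens = topid Q a, mpar = botid Q a\<rparr>"

context
  fixes Q :: "('o, 'm) two_comp_category"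
  assumes tens: "quantaloid (tens_category Q)"
    and par: "quantaloid (co (par_category Q))"
begin

text \<open>By the unit laws of both compositions, every action and coaction condition reduces to
  reflexivity. Only the two quantaloid structures are assumed in this context, since the
  distributive laws are yet to be derived from \<open>Mon Q\<close>.\<close>

lemma linear_module_trivial_monad:
  assumes "a \<in> Obj Q" "b \<in> Obj Q"
  shows "linear_module Q (trivial_monad Q a) (trivial_monad Q b) f \<longleftrightarrow> f \<in> Arr Q a b"
proof -
  interpret t: quantaloid "tens_category Q" by (rule tens)
  interpret p: quantaloid "co (par_category Q)" by (rule par)
  interpret complete_lattice "Hom Q a b" using assms t.homs_complete_lattice by simp
  show ?thesis
    using assms t.ident_left t.ident_right p.ident_left p.ident_right
    by (auto simp: linear_module_def trivial_monad_def)
qed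

lemma linear_monad_trivial_monad:
  assumes "a \<in> Obj Q"
  shows "linear_monad Q (trivial_monad Q a)"
proof -
  interpret t: quantaloid "tens_category Q" by (rule tens)
  interpret p: quantaloid "co (par_category Q)" by (rule par)
  interpret complete_lattice "Hom Q a a" using assms t.homs_complete_lattice by simp
  show ?thesis
    using assms t.ident_left t.ident_right p.ident_left p.ident_right t.ident_closed p.ident_closed
    by (auto simp: linear_monad_def trivial_monad_def)
qed

lemma linear_quantaloid_if_Mon:
  assumes "linear_quantaloid (Mon Q)"
  shows "linear_quantaloid Q"
proof (rule linear_quantaloid.intro[OF tens par])
  fix a b c d f g h
  assume *: "a \<in> Obj Q" "b \<in> Obj Q" "c \<in> Obj Q" "d \<in> Obj Q"
    "f \<in> Arr Q a b" "g \<in> Arr Q b c" "h \<in> Arr Q c d"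
  let ?t = "trivial_monad Q"
  \<comment> \<open>The given arrows become modules between trivial monads; as \<open>Mon Q\<close>
    inherits order and compositions, its distributive laws for them are literally those of
    \<open>Q\<close>.\<close>
  have M: "?t a \<in> Obj (Mon Q)" "?t b \<in> Obj (Mon Q)" "?t c \<in> Obj (Mon Q)" "?t d \<in> Obj (Mon Q)"
    "f \<in> Arr (Mon Q) (?t a) (?t b)" "g \<in> Arr (Mon Q) (?t b) (?t c)" "h \<in> Arr (Mon Q) (?t c) (?t d)"
    using * by (auto simp: Mon_def linear_monad_trivial_monad linear_module_trivial_monad)
  show "tens Q a b d f (par Q b c d g h) \<sqsubseteq>\<^bsub>Hom Q a d\<^esub> par Q a c d (tens Q a b c f g) h"
    using linear_quantaloid.linear_distrib_left[OF assms M] by (simp add: Mon_def trivial_monad_def)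
  show "tens Q a c d (par Q a b c f g) h \<sqsubseteq>\<^bsub>Hom Q a d\<^esub> par Q a b d f (tens Q b c d g h)"
    using linear_quantaloid.linear_distrib_right[OF assms M] by (simp add: Mon_def trivial_monad_def)
qed

end

theorem theorem6p17:
  fixes Q :: "('o, 'm) two_comp_category"
  assumes "quantaloid (tens_category Q)"
    and "quantaloid (co (par_category Q))"
  shows "linear_quantaloid (Mon Q) \<longleftrightarrow> linear_quantaloid Q"
  using linear_quantaloid_if_Mon[OF assms] linear_quantaloid.linear_quantaloid_Mon by blast

end
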